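(* For $X,Y,Z\in\mathbb{R}$ let \[ v_1(X,Y,Z)=(0,X,Y,Z,0,0,0,0),\qquad v_2(X,Y,Z)=(0,Y,Z,X,0,0,0,0) \] be octonions written in coordinates with respect to $e_0,\dots,e_7$, and let $v(X,Y,Z)=v_1(X,Y,Z)+v_2(X,Y,Z)e_8\in S$. Writing $D_2(X,Y,Z):=D_2(v(X,Y,Z))$, one has \[ D_2(X,Y,Z)=4(XY+YZ+ZX)^2 . \] Hence, for $X,Y,Z\in\mathbb{R}$, the sedenion $v(X,Y,Z)$ is a left zero-divisor if and only if $XY+YZ+ZX=0$.
   Context: $\mathbb{O}$ is the real algebra of octonions with standard orthonormal basis $e_0=1,e_1,\dots,e_7$, conjugation $x\mapsto\overline{x}$, standard Euclidean inner product $\langle\cdot,\cdot\rangle$ and norm $\|\cdot\|$ on $\mathbb{O}\cong\mathbb{R}^8$ (so $x\overline{x}=\|x\|^2e_0$), and $\operatorname{Im}(\mathbb{O})=\operatorname{span}\{e_1,\dots,e_7\}$. Concretely, $\mathbb{O}=\mathbb{H}\oplus\mathbb{H}e_4$ with product $(x+ye_4)(z+te_4)=(xz-\overline{t}\,y)+(tx+y\overline{z})e_4$ and conjugation $\overline{x+ye_4}=\overline{x}-ye_4$, where $\mathbb{H}=\operatorname{span}\{e_0,e_1,e_2,e_3\}$ is the quaternion algebra. The sedenion algebra $S$ is the real vector space $\mathbb{O}\oplus\mathbb{O}\cong\mathbb{R}^{16}$, whose elements are written uniquely as $v=v_1+v_2e_8$ with $v_1,v_2\in\mathbb{O}$, with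 multiplication \[ (a+be_8)(c+de_8)=(ac-\overline{d}\,b)+(da+b\overline{c})e_8,\qquad a,b,c,d\in\mathbb{O}. \] An element $v\in S$ is a left zero-divisor if there exists $y\in S$, $y\neq 0$, with $vy=0$ (in this convention $v=0$ counts as a left zero-divisor). For $v=v_1+v_2e_8\in S$ with $v_1=x_1e_0+u$, $v_2=x_2e_0+w$, $x_1,x_2\in\mathbb{R}$, $u,w\in\operatorname{Im}(\mathbb{O})$, set \[ D_2(v):=\bigl(\|v_1\|^2+\|v_2\|^2\bigr)^2-4\bigl(\|u\|^2\|w\|^2-\langle u,w\rangle^2\bigr). \] *)

theory Defs
  imports "HOL-Analysis.Analysis"
begin

text \<open>
  Quaternions, octonions and sedenions are iterated products of the reals, so that the vector space
  structure, the Euclidean inner product and the Euclidean norm are those of the library.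
  Only the multiplications and conjugations are new. The nested pairs list the coordinates
  with respect to the standard basis in its usual order.
\<close>

type_synonym quaternion = "real \<times> real \<times> real \<times> real"
type_synonym octonion = "quaternion \<times> quaternion"
type_synonym sedenion = "octonion \<times> octonion"

fun quat_mult :: "quaternion \<Rightarrow> quaternion \<Rightarrow> quaternion" (infixl "\<cdot>\<^sub>H" 70) where
  "(a0, a1, a2, a3) \<cdot>\<^sub>H (b0, b1, b2, b3) =
    (a0 * b0 - a1 * b1 - a2 * b2 - a3 * b3,
     a0 * b1 + a1 * b0 + a2 * b3 - a3 * b2,
     a0 * b2 - a1 * b3 + a2 * b0 + a3 * b1,
     a0 * b3 + a1 * b2 - a2 * b1 + a3 * b0)"

fun quat_cnj :: "quaternion \<Rightarrow> quaternion" where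
  "quat_cnj (a0, a1, a2, a3) = (a0, - a1, - a2, - a3)"

text \<open>The pair \<open>(x, y)\<close> of quaternions stands for \<open>x + y e\<^sub>4\<close>.\<close>

fun oct_mult :: "octonion \<Rightarrow> octonion \<Rightarrow> octonion" (infixl "\<cdot>\<^sub>O" 70) where
  "(x, y) \<cdot>\<^sub>O (z, t) =
    (x \<cdot>\<^sub>H z - quat_cnj t \<cdot>\<^sub>H y, t \<cdot>\<^sub>H x + y \<cdot>\<^sub>H quat_cnj z)"

fun oct_cnj :: "octonion \<Rightarrow> octonion" where
  "oct_cnj (x, y) = (quat_cnj x, - y)"

text \<open>The pair \<open>(a, b)\<close> of octonions stands for \<open>a + b e\<^sub>8\<close>.\<close>

fun sed_mult :: "sedenion \<Rightarrow> sedenion \<Rightarrow> sedenion" (infixl "\<cdot>\<^sub>S" 70) where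
  "(a, b) \<cdot>\<^sub>S (c, d) =
    (a \<cdot>\<^sub>O c - oct_cnj d \<cdot>\<^sub>O b, d \<cdot>\<^sub>O a + b \<cdot>\<^sub>O oct_cnj c)"

text \<open>Under this definition \<open>0\<close> is a left zero-divisor.\<close>

definition left_zero_divisor :: "sedenion \<Rightarrow> bool" where
  "left_zero_divisor v \<longleftrightarrow> (\<exists>y. y \<noteq> 0 \<and> v \<cdot>\<^sub>S y = 0)"

definition octonion_of_coords ::
    "real \<Rightarrow> real \<Rightarrow> real \<Rightarrow> real \<Rightarrow> real \<Rightarrow> real \<Rightarrow> real \<Rightarrow> real \<Rightarrow> octonion" where
  "octonion_of_coords x0 x1 x2 x3 x4 x5 x6 x7 = ((x0, x1, x2, x3), (x4, x5, x6, x7))"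

definition oct_e0 :: octonion where
  "oct_e0 = octonion_of_coords 1 0 0 0 0 0 0 0"

definition oct_Re :: "octonion \<Rightarrow> real" where
  "oct_Re a = a \<bullet> oct_e0"

definition oct_Im :: "octonion \<Rightarrow> octonion" where
  "oct_Im a = a - oct_Re a *\<^sub>R oct_e0"

definition D2 :: "sedenion \<Rightarrow> real" where
  "D2 v =
    (let v1 = fst v; v2 = snd v; u = oct_Im v1; w = oct_Im v2
     in ((norm v1)\<^sup>2 + (norm v2)\<^sup>2)\<^sup>2 - 4 * ((norm u)\<^sup>2 * (norm w)\<^sup>2 - (u \<bullet> w)\<^sup>2))"

definition v1_xyz :: "real \<Rightarrow> real \<Rightarrow> real \<Rightarrow> octonion" where
  "v1_xyz X Y Z = octonion_of_coords 0 X Y Z 0 0 0 0"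

definition v2_xyz :: "real \<Rightarrow> real \<Rightarrow> real \<Rightarrow> octonion" where
  "v2_xyz X Y Z = octonion_of_coords 0 Y Z X 0 0 0 0"

definition v_xyz :: "real \<Rightarrow> real \<Rightarrow> real \<Rightarrow> sedenion" where
  "v_xyz X Y Z = (v1_xyz X Y Z, v2_xyz X Y Z)"

lemma oct_mult_cnj: "x \<cdot>\<^sub>O oct_cnj x = (norm x)\<^sup>2 *\<^sub>R oct_e0"
proof -
  obtain a0 a1 a2 a3 b0 b1 b2 b3 where x: "x = ((a0, a1, a2, a3), (b0, b1, b2, b3))"
    by (metis prod.collapse)
  show ?thesis
    unfolding x oct_e0_def octonion_of_coords_def power2_norm_eq_inner
    by (simp add: zero_prod_def algebra_simps)
qed

lemma sed_pair_eq: "((a, b) :: sedenion) = (a, 0) + (b, 0) \<cdot>\<^sub>S (0, oct_e0)"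
proof -
  obtain a0 a1 a2 a3 b0 b1 b2 b3 where b: "b = ((a0, a1, a2, a3), (b0, b1, b2, b3))"
    by (metis prod.collapse)
  show ?thesis
    unfolding b by (simp add: oct_e0_def octonion_of_coords_def zero_prod_def)
qed

end

theory Submission
  imports Defs
begin

text \<open>
  Both halves of \<open>v_xyz X Y Z\<close> are imaginary quaternions \<open>u\<close>, \<open>w\<close>, regarded as octonions. They have
  the same norm, and \<open>u \<bullet> w = X * Y + Y * Z + Z * X\<close>. The Gram determinant in \<open>D2\<close> therefore leaves
  \<open>4 * (u \<bullet> w)\<^sup>2\<close>.

  For arbitrary imaginary quaternions \<open>u\<close>, \<open>w\<close> (lemma \<open>left_zero_divisor_imag_quat_iff\<close>), the
  sedenion \<open>u + w e\<^sub>8\<close> is a left zero-divisor exactly when \<open>D2\<close> vanishes. Write an annihilated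
  sedenion as \<open>(c + p e\<^sub>4) + (d + r e\<^sub>4) e\<^sub>8\<close>. Left multiplication by \<open>u + w e\<^sub>8\<close> preserves the
  splitting into the \<open>(c, d)\<close> part and the \<open>(p, r)\<close> part, and all products become products in the
  associative algebra of quaternions. The \<open>(c, d)\<close> part must vanish unless \<open>u = w = 0\<close>, since there
  the map is injective (\<open>quat_part_injective\<close>). On the \<open>(p, r)\<close> part the order of the factors is
  reversed, and the equations \<open>p u = r w\<close>, \<open>r u = - p w\<close> combine with the Clifford relation
  \<open>u w + w u = - 2 (u \<bullet> w)\<close> to a real \<open>2 \<times> 2\<close> system for \<open>p\<close> and \<open>r\<close> (\<open>e4_part_relation\<close>).
  Its determinant is \<open>((norm u)\<^sup>2 - (norm w)\<^sup>2)\<^sup>2 + 4 * (u \<bullet> w)\<^sup>2\<close>, which is \<open>D2\<close>. If it is zero, then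
  \<open>u\<close> and \<open>w\<close> are orthogonal of equal norm, hence anticommute with equal squares, and
  \<open>p = w u\<close>, \<open>r = - (norm u)\<^sup>2\<close> is a solution.
\<close>

lemma Pair_eq_zero_iff: "(a, b) = 0 \<longleftrightarrow> a = 0 \<and> b = 0"
  by (simp add: zero_prod_def)

lemma quat_mult_assoc: "(a \<cdot>\<^sub>H b) \<cdot>\<^sub>H c = a \<cdot>\<^sub>H (b \<cdot>\<^sub>H c)"
  by (cases a; cases b; cases c) (simp add: algebra_simps)

lemma quat_mult_zero [simp]: "0 \<cdot>\<^sub>H a = 0" "a \<cdot>\<^sub>H 0 = 0"
  by (cases a; simp add: zero_prod_def)+

lemma quat_mult_minus [simp]:
  "(- a) \<cdot>\<^sub>H b = - (a \<cdot>\<^sub>H b)" "a \<cdot>\<^sub>H (- b) = - (a \<cdot>\<^sub>H b)"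
  by (cases a; cases b; simp)+

lemma quat_cnj_mult: "quat_cnj (a \<cdot>\<^sub>H b) = quat_cnj b \<cdot>\<^sub>H quat_cnj a"
  by (cases a; cases b) (simp add: algebra_simps)

lemma quat_cnj_cnj [simp]: "quat_cnj (quat_cnj a) = a"
  by (cases a) simp

lemma quat_cnj_zero [simp]: "quat_cnj 0 = 0"
  by (simp add: zero_prod_def)

lemma quat_cnj_eq_zero_iff [simp]: "quat_cnj a = 0 \<longleftrightarrow> a = 0"
  by (metis quat_cnj_cnj quat_cnj_zero)

lemma quat_cnj_minus [simp]: "quat_cnj (- a) = - quat_cnj a"
  by (cases a) simp

text \<open>
  The Clifford relation \<open>u w + w u = - 2 (u \<bullet> w)\<close> of imaginary quaternions, multiplied from the left
  by \<open>p\<close> so that the real number on its right-hand side acts as a scalar.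
\<close>

lemma imag_quat_clifford:
  assumes "quat_cnj u = - u" "quat_cnj w = - w"
  shows "(p \<cdot>\<^sub>H u) \<cdot>\<^sub>H w + (p \<cdot>\<^sub>H w) \<cdot>\<^sub>H u = (- 2 * (u \<bullet> w)) *\<^sub>R p"
  using assms by (cases p; cases u; cases w) (simp add: algebra_simps)

lemma imag_quat_square_right:
  assumes "quat_cnj u = - u"
  shows "(p \<cdot>\<^sub>H u) \<cdot>\<^sub>H u = - ((norm u)\<^sup>2 *\<^sub>R p)"
  using assms unfolding power2_norm_eq_inner
  by (cases p; cases u) (simp add: algebra_simps)

lemma imag_quat_square_left:
  assumes "quat_cnj u = - u"
  shows "u \<cdot>\<^sub>H (u \<cdot>\<^sub>H p) = - ((norm u)\<^sup>2 *\<^sub>R p)"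
  using assms unfolding power2_norm_eq_inner
  by (cases p; cases u) (simp add: algebra_simps)

text \<open>
  Multiplication by an element of the quaternions twisted by \<open>e\<^sub>4\<close> reverses the order of the
  quaternionic factors. This is why the two components with index \<open>p\<close>, \<open>r\<close> have \<open>u\<close> and \<open>w\<close> on the
  right only, so that the Clifford relation applies to them, but not to the other two.
\<close>

lemma imag_quat_sed_mult:
  assumes "quat_cnj u = - u" "quat_cnj w = - w"
  shows "((u, 0), (w, 0)) \<cdot>\<^sub>S ((c, p), (d, r)) =
    ((u \<cdot>\<^sub>H c - quat_cnj d \<cdot>\<^sub>H w, p \<cdot>\<^sub>H u - r \<cdot>\<^sub>H w),
     (d \<cdot>\<^sub>H u + w \<cdot>\<^sub>H quat_cnj c, - (r \<cdot>\<^sub>H u) - p \<cdot>\<^sub>H w))"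
  using assms by simp

text \<open>
  Here \<open>u\<close> acts from the left and \<open>w\<close> from the right, so the two actions commute. Computing
  \<open>(c w) w\<close> through both equations gives \<open>- (norm w)\<^sup>2 c = (norm u)\<^sup>2 c\<close>, and the signs force \<open>c = 0\<close>.
\<close>

lemma quat_part_injective:
  assumes u: "quat_cnj u = - u" and w: "quat_cnj w = - w" and nz: "u \<noteq> 0 \<or> w \<noteq> 0"
    and 1: "u \<cdot>\<^sub>H c = e \<cdot>\<^sub>H w" and 2: "u \<cdot>\<^sub>H e = - (c \<cdot>\<^sub>H w)"
  shows "c = 0"
proof -
  have "- ((norm w)\<^sup>2 *\<^sub>R c) = (c \<cdot>\<^sub>H w) \<cdot>\<^sub>H w"
    by (simp add: imag_quat_square_right w)
  also have "\<dots> = - ((u \<cdot>\<^sub>H e) \<cdot>\<^sub>H w)"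
    by (simp add: 2)
  also have "\<dots> = - (u \<cdot>\<^sub>H (u \<cdot>\<^sub>H c))"
    by (simp add: quat_mult_assoc 1)
  also have "\<dots> = (norm u)\<^sup>2 *\<^sub>R c"
    by (simp add: imag_quat_square_left u)
  finally have "((norm u)\<^sup>2 + (norm w)\<^sup>2) *\<^sub>R c = 0"
    by (metis add.right_inverse add.commute scaleR_add_left)
  moreover have "(norm u)\<^sup>2 + (norm w)\<^sup>2 \<noteq> 0"
    using nz by (simp add: sum_power2_eq_zero_iff)
  ultimately show ?thesis by (metis scaleR_eq_0_iff)
qed

text \<open>
  One row of the real linear system for \<open>p\<close> and \<open>r\<close>. The hypotheses are invariant under replacing
  \<open>(p, r)\<close> by \<open>(r, - p)\<close>, which yields the other row.
\<close>

lemma e4_part_relation: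
  assumes u: "quat_cnj u = - u" and w: "quat_cnj w = - w"
    and 1: "p \<cdot>\<^sub>H u = r \<cdot>\<^sub>H w" and 2: "r \<cdot>\<^sub>H u = - (p \<cdot>\<^sub>H w)"
  shows "(- 2 * (u \<bullet> w)) *\<^sub>R p = ((norm u)\<^sup>2 - (norm w)\<^sup>2) *\<^sub>R r"
proof -
  have "(- 2 * (u \<bullet> w)) *\<^sub>R p = (p \<cdot>\<^sub>H u) \<cdot>\<^sub>H w + (p \<cdot>\<^sub>H w) \<cdot>\<^sub>H u"
    by (simp only: imag_quat_clifford[OF u w])
  also have "\<dots> = (r \<cdot>\<^sub>H w) \<cdot>\<^sub>H w + (- (r \<cdot>\<^sub>H u)) \<cdot>\<^sub>H u"
    by (simp only: 1 2 minus_minus)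
  also have "\<dots> = ((norm u)\<^sup>2 - (norm w)\<^sup>2) *\<^sub>R r"
    by (simp add: imag_quat_square_right u w scaleR_diff_left)
  finally show ?thesis .
qed

lemma e4_part_injective:
  assumes u: "quat_cnj u = - u" and w: "quat_cnj w = - w"
    and nz: "((norm u)\<^sup>2 - (norm w)\<^sup>2)\<^sup>2 + 4 * (u \<bullet> w)\<^sup>2 \<noteq> 0"
    and 1: "p \<cdot>\<^sub>H u = r \<cdot>\<^sub>H w" and 2: "r \<cdot>\<^sub>H u = - (p \<cdot>\<^sub>H w)"
  shows "p = 0"
proof -
  define \<delta> where "\<delta> = (norm u)\<^sup>2 - (norm w)\<^sup>2"
  define \<beta> where "\<beta> = - 2 * (u \<bullet> w)"
  have "\<beta> *\<^sub>R p = \<delta> *\<^sub>R r"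
    using e4_part_relation[OF u w 1 2] by (simp only: \<beta>_def \<delta>_def)
  moreover have "\<beta> *\<^sub>R r = \<delta> *\<^sub>R (- p)"
    unfolding \<beta>_def \<delta>_def by (rule e4_part_relation[OF u w]) (simp_all add: 1 2)
  ultimately have "\<beta> *\<^sub>R \<beta> *\<^sub>R p = \<delta> *\<^sub>R \<delta> *\<^sub>R (- p)"
    by (metis scaleR_left_commute)
  then have "(\<delta>\<^sup>2 + \<beta>\<^sup>2) *\<^sub>R p = 0"
    by (simp add: scaleR_add_left power2_eq_square)
  with nz show ?thesis
    by (simp add: \<delta>_def \<beta>_def power_mult_distrib)
qed

text \<open>In this form \<open>D2\<close> is visibly a sum of squares, and the determinant of the system above.\<close>

lemma D2_imag_quat:
  assumes "quat_cnj u = - u" "quat_cnj w = - w"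
  shows "D2 ((u, 0), (w, 0)) = ((norm u)\<^sup>2 - (norm w)\<^sup>2)\<^sup>2 + 4 * (u \<bullet> w)\<^sup>2"
proof -
  have Im: "oct_Im (a, 0) = (a, 0)" if "quat_cnj a = - a" for a
    using that
    by (cases a) (simp add: oct_Im_def oct_Re_def oct_e0_def octonion_of_coords_def zero_prod_def)
  show ?thesis
    by (simp add: D2_def Im assms Let_def norm_Pair power2_eq_square algebra_simps)
qed

lemma left_zero_divisor_imag_quat_iff:
  assumes u: "quat_cnj u = - u" and w: "quat_cnj w = - w"
  shows "left_zero_divisor ((u, 0), (w, 0)) \<longleftrightarrow> D2 ((u, 0), (w, 0)) = 0"
proof
  assume "left_zero_divisor ((u, 0), (w, 0))"
  then obtain c p d r where nz: "((c, p), (d, r)) \<noteq> (0 :: sedenion)"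
    and "((u, 0), (w, 0)) \<cdot>\<^sub>S ((c, p), (d, r)) = 0"
    unfolding left_zero_divisor_def by (metis prod.collapse)
  then have 1: "u \<cdot>\<^sub>H c = quat_cnj d \<cdot>\<^sub>H w" and 2: "d \<cdot>\<^sub>H u = - (w \<cdot>\<^sub>H quat_cnj c)"
    and 3: "p \<cdot>\<^sub>H u = r \<cdot>\<^sub>H w" and 4: "r \<cdot>\<^sub>H u = - (p \<cdot>\<^sub>H w)"
    unfolding imag_quat_sed_mult[OF u w]
    by (simp_all add: Pair_eq_zero_iff add_eq_0_iff2 diff_eq_eq minus_equation_iff)
  \<comment> \<open>Conjugation turns \<open>2\<close> into an equation with \<open>u\<close> on the left and \<open>w\<close> on the right, as in \<open>1\<close>.\<close>
  have 2: "u \<cdot>\<^sub>H quat_cnj d = - (c \<cdot>\<^sub>H w)"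
    using arg_cong[OF 2, of quat_cnj] by (simp add: quat_cnj_mult u w minus_equation_iff)
  show "D2 ((u, 0), (w, 0)) = 0"
  proof (rule ccontr)
    assume "D2 ((u, 0), (w, 0)) \<noteq> 0"
    then have D: "((norm u)\<^sup>2 - (norm w)\<^sup>2)\<^sup>2 + 4 * (u \<bullet> w)\<^sup>2 \<noteq> 0"
      unfolding D2_imag_quat[OF u w] .
    then have uw: "u \<noteq> 0 \<or> w \<noteq> 0"
      by (cases "u = 0") auto
    have "c = 0"
      by (rule quat_part_injective[OF u w uw 1 2])
    \<comment> \<open>Both systems are invariant under a quarter turn of the pair of unknowns.\<close>
    moreover have "quat_cnj d = 0"
      by (rule quat_part_injective[OF u w uw, where e = "- c"]) (simp_all add: 1 2)
    moreover have "p = 0"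
      by (rule e4_part_injective[OF u w D 3 4])
    moreover have "r = 0"
      by (rule e4_part_injective[OF u w D, where r = "- p"]) (simp_all add: 3 4)
    ultimately show False
      using nz by (simp add: Pair_eq_zero_iff)
  qed
next
  assume "D2 ((u, 0), (w, 0)) = 0"
  then have eq: "(norm u)\<^sup>2 = (norm w)\<^sup>2" and orth: "u \<bullet> w = 0"
    by (simp_all add: D2_imag_quat[OF u w] add_nonneg_eq_0_iff)
  show "left_zero_divisor ((u, 0), (w, 0))"
  proof (cases "u = 0")
    case True
    with eq have "w = 0" by simp
    then have "((u, 0), (w, 0)) \<cdot>\<^sub>S (((1, 0, 0, 0), 0), (0, 0)) = 0"
      by (simp only: imag_quat_sed_mult[OF u w] True) (simp add: Pair_eq_zero_iff)
    moreover have "(((1, 0, 0, 0), 0), (0, 0)) \<noteq> (0 :: sedenion)"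
      by (simp add: Pair_eq_zero_iff)
    ultimately show ?thesis
      unfolding left_zero_divisor_def by (intro exI conjI)
  next
    case False
    define r :: quaternion where "r = (- ((norm u)\<^sup>2), 0, 0, 0)"
    have r_mult: "r \<cdot>\<^sub>H a = - ((norm u)\<^sup>2 *\<^sub>R a)" for a
      by (cases a) (simp add: r_def)
    have pu: "(w \<cdot>\<^sub>H u) \<cdot>\<^sub>H u = r \<cdot>\<^sub>H w"
      by (simp add: imag_quat_square_right u r_mult)
    have "(w \<cdot>\<^sub>H u) \<cdot>\<^sub>H w = - (w \<cdot>\<^sub>H (w \<cdot>\<^sub>H u))"
      using imag_quat_clifford[OF u w, of w] orth
      by (simp add: quat_mult_assoc eq_neg_iff_add_eq_0)
    also have "\<dots> = - (r \<cdot>\<^sub>H u)"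
      by (simp add: imag_quat_square_left w r_mult eq)
    finally have pw: "(w \<cdot>\<^sub>H u) \<cdot>\<^sub>H w = - (r \<cdot>\<^sub>H u)" .
    have "((u, 0), (w, 0)) \<cdot>\<^sub>S ((0, w \<cdot>\<^sub>H u), (0, r)) = 0"
      unfolding imag_quat_sed_mult[OF u w] by (simp add: pu pw Pair_eq_zero_iff)
    moreover have "((0, w \<cdot>\<^sub>H u), (0, r)) \<noteq> (0 :: sedenion)"
      using False by (simp add: r_def Pair_eq_zero_iff)
    ultimately show ?thesis
      unfolding left_zero_divisor_def by (intro exI conjI)
  qed
qed

theorem theorem5p3:
  fixes X Y Z :: real
  shows "D2 (v_xyz X Y Z) = 4 * (X * Y + Y * Z + Z * X)\<^sup>2 \<and>
    (left_zero_divisor (v_xyz X Y Z) \<longleftrightarrow> X * Y + Y * Z + Z * X = 0)"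
proof -
  define u w :: quaternion where "u = (0, X, Y, Z)" and "w = (0, Y, Z, X)"
  have u: "quat_cnj u = - u" and w: "quat_cnj w = - w"
    by (simp_all add: u_def w_def)
  have v: "v_xyz X Y Z = ((u, 0), (w, 0))"
    by (simp add: v_xyz_def v1_xyz_def v2_xyz_def octonion_of_coords_def u_def w_def zero_prod_def)
  have "(norm u)\<^sup>2 = (norm w)\<^sup>2"
    unfolding power2_norm_eq_inner by (simp add: u_def w_def)
  moreover have "u \<bullet> w = X * Y + Y * Z + Z * X"
    by (simp add: u_def w_def)
  ultimately have D: "D2 (v_xyz X Y Z) = 4 * (X * Y + Y * Z + Z * X)\<^sup>2"
    by (simp add: v D2_imag_quat[OF u w])
  moreover have "left_zero_divisor (v_xyz X Y Z) \<longleftrightarrow> D2 (v_xyz X Y Z) = 0"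
    unfolding v by (rule left_zero_divisor_imag_quat_iff[OF u w])
  ultimately show ?thesis by simp
qed

end
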